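(* Let $n\ge 3$ be an integer and let $D_{2n}=\langle a,b : a^n=b^2=1,\ bab^{-1}=a^{-1}\rangle$ be the dihedral group. Then each of the graphs $\Gamma=\mathrm{ESCom}(D_{2n})$, $\Gamma=\mathrm{CSCom}(D_{2n})$ and $\Gamma=\mathrm{OSCom}(D_{2n})$ satisfies the Hansen--Vukičević inequality \[ \frac{M_2(\Gamma)}{|e(\Gamma)|}\ \ge\ \frac{M_1(\Gamma)}{|v(\Gamma)|}. \]
   Context: For an equivalence relation $B$ on a finite group $G$, with $[g]$ the class of $g$, the $B$ super commuting graph of $G$ is the simple graph with vertex set $G$ in which two distinct vertices $g,h$ are adjacent if and only if $[g]=[h]$ or there exist $g'\in[g]$, $h'\in[h]$ with $g'h'=h'g'$. It is denoted $\mathrm{ESCom}(G)$ when $B$ is equality (so $g\ne h$ are adjacent iff $gh=hg$), $\mathrm{CSCom}(G)$ when $B$ is conjugacy in $G$, and $\mathrm{OSCom}(G)$ when $B$ is the relation of having the same order. For a finite simple graph $\Gamma$ with vertex set $v(\Gamma)$ and edge set $e(\Gamma)$, the first and second Zagreb indices are $M_1(\Gamma)=\sum_{v\in v(\Gamma)}\deg(v)^2$ and $M_2(\Gamma)=\sum_{uv\in e(\Gamma)}\deg(u)\deg(v)$. *)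

theory Defs
  imports Complex_Main "HOL-Algebra.Multiplicative_Group"
begin

text \<open>Group presentations. A letter \<open>(x, True)\<close> of a word stands for the generator \<open>x\<close>, and
  \<open>(x, False)\<close> for its formal inverse. The generators are all elements of the type \<open>'g\<close>, and
  a pair \<open>(u, v)\<close> of words in \<open>R\<close> is a defining relation \<open>u = v\<close>.\<close>

type_synonym 'g word = "('g \<times> bool) list"

inductive word_eq :: "('g word \<times> 'g word) set \<Rightarrow> 'g word \<Rightarrow> 'g word \<Rightarrow> bool"
  for R :: "('g word \<times> 'g word) set" where
  relation: "(u, v) \<in> R \<Longrightarrow> word_eq R u v"
| cancel: "word_eq R [(x, e), (x, \<not> e)] []"
| append: "word_eq R u u' \<Longrightarrow> word_eq R v v' \<Longrightarrow> word_eq R (u @ v) (u' @ v')"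
| refl: "word_eq R u u"
| sym: "word_eq R u v \<Longrightarrow> word_eq R v u"
| trans: "word_eq R u v \<Longrightarrow> word_eq R v w \<Longrightarrow> word_eq R u w"

definition presented_group :: "('g word \<times> 'g word) set \<Rightarrow> 'g word set monoid" where
  "presented_group R =
     \<lparr> carrier = UNIV // {(u, v). word_eq R u v},
       mult = (\<lambda>A B. {w. \<exists>u\<in>A. \<exists>v\<in>B. word_eq R (u @ v) w}),
       one = {w. word_eq R [] w} \<rparr>"

datatype dihedral_gen = gen_a | gen_b

definition dihedral_relations :: "nat \<Rightarrow> (dihedral_gen word \<times> dihedral_gen word) set" where
  "dihedral_relations n =
     {(replicate n (gen_a, True), []),
      ([(gen_b, True), (gen_b, True)], []),
      ([(gen_b, True), (gen_a, True), (gen_b, False)], [(gen_a, False)])}"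

text \<open>The dihedral group \<open>D\<^sub>2\<^sub>n\<close>; the argument is \<open>n\<close>, not the order \<open>2n\<close>.\<close>

definition dihedral_group :: "nat \<Rightarrow> dihedral_gen word set monoid" where
  "dihedral_group n = presented_group (dihedral_relations n)"

text \<open>Finite simple graphs: edges are two-element sets of vertices.\<close>

record 'v ugraph =
  verts :: "'v set"
  edges :: "'v set set"

definition degree :: "'v ugraph \<Rightarrow> 'v \<Rightarrow> nat" where
  "degree \<Gamma> v = card {e \<in> edges \<Gamma>. v \<in> e}"

definition zagreb1 :: "'v ugraph \<Rightarrow> nat" where
  "zagreb1 \<Gamma> = (\<Sum>v\<in>verts \<Gamma>. degree \<Gamma> v ^ 2)"

text \<open>For an edge \<open>e = {u, v}\<close> the inner product is \<open>degree \<Gamma> u * degree \<Gamma> v\<close>.\<close>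

definition zagreb2 :: "'v ugraph \<Rightarrow> nat" where
  "zagreb2 \<Gamma> = (\<Sum>e\<in>edges \<Gamma>. \<Prod>v\<in>e. degree \<Gamma> v)"

text \<open>The \<open>B\<close> super commuting graph, for an equivalence relation \<open>B\<close> on the carrier of \<open>G\<close>;
  the class of \<open>g\<close> is \<open>B `` {g}\<close>.\<close>

definition super_commuting_graph :: "('a, 'm) monoid_scheme \<Rightarrow> ('a \<times> 'a) set \<Rightarrow> 'a ugraph" where
  "super_commuting_graph G B =
     \<lparr> verts = carrier G,
       edges = {{g, h} | g h. g \<in> carrier G \<and> h \<in> carrier G \<and> g \<noteq> h \<and>
         (B `` {g} = B `` {h} \<or>
          (\<exists>g'\<in>B `` {g}. \<exists>h'\<in>B `` {h}. g' \<otimes>\<^bsub>G\<^esub> h' = h' \<otimes>\<^bsub>G\<^esub> g'))} \<rparr>"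

definition conjugacy_rel :: "('a, 'm) monoid_scheme \<Rightarrow> ('a \<times> 'a) set" where
  "conjugacy_rel G = {(g, h). g \<in> carrier G \<and> h \<in> carrier G \<and>
     (\<exists>x\<in>carrier G. h = x \<otimes>\<^bsub>G\<^esub> g \<otimes>\<^bsub>G\<^esub> inv\<^bsub>G\<^esub> x)}"

definition same_order_rel :: "('a, 'm) monoid_scheme \<Rightarrow> ('a \<times> 'a) set" where
  "same_order_rel G = {(g, h). g \<in> carrier G \<and> h \<in> carrier G \<and> group.ord G g = group.ord G h}"

definition ESCom :: "('a, 'm) monoid_scheme \<Rightarrow> 'a ugraph" where
  "ESCom G = super_commuting_graph G (Id_on (carrier G))"

definition CSCom :: "('a, 'm) monoid_scheme \<Rightarrow> 'a ugraph" where
  "CSCom G = super_commuting_graph G (conjugacy_rel G)"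

definition OSCom :: "('a, 'm) monoid_scheme \<Rightarrow> 'a ugraph" where
  "OSCom G = super_commuting_graph G (same_order_rel G)"

lemma equiv_word_eq: "equiv UNIV {(u, v). word_eq R u v}"
  by (rule equivI) (auto simp: refl_on_def sym_def trans_def intro: word_eq.intros)

lemma presented_group_mult_class:
  "{w. word_eq R u w} \<otimes>\<^bsub>presented_group R\<^esub> {w. word_eq R v w} = {w. word_eq R (u @ v) w}"
  by (auto simp: presented_group_def intro: word_eq.intros)

lemma carrier_presented_group: "carrier (presented_group R) = range (\<lambda>u. {w. word_eq R u w})"
  by (auto simp: presented_group_def quotient_def)

lemma word_eq_inverse: "word_eq R (rev (map (\<lambda>(x, e). (x, \<not> e)) u) @ u) []"
proof (induction u)
  case Nil
  show ?case by (simp add: word_eq.refl)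
next
  case (Cons l u)
  obtain x e where l: "l = (x, e)" by (cases l)
  let ?r = "rev (map (\<lambda>(x, e). (x, \<not> e)) u)"
  have "word_eq R [(x, \<not> e), (x, e)] []"
    using word_eq.cancel[of R x "\<not> e"] by simp
  then have "word_eq R (?r @ ([(x, \<not> e), (x, e)] @ u)) (?r @ ([] @ u))"
    by (intro word_eq.append word_eq.refl)
  then show ?case
    using Cons.IH by (auto simp: l intro: word_eq.trans)
qed

lemma group_presented_group: "group (presented_group R)"
proof (rule groupI)
  let ?G = "presented_group R" and ?c = "\<lambda>u. {w. word_eq R u w}"
  have one: "\<one>\<^bsub>?G\<^esub> = ?c []"
    by (simp add: presented_group_def)
  show "\<one>\<^bsub>?G\<^esub> \<in> carrier ?G"
    by (auto simp: one carrier_presented_group)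
  show "x \<otimes>\<^bsub>?G\<^esub> y \<in> carrier ?G" if "x \<in> carrier ?G" "y \<in> carrier ?G" for x y
    using that by (auto simp: carrier_presented_group presented_group_mult_class)
  show "x \<otimes>\<^bsub>?G\<^esub> y \<otimes>\<^bsub>?G\<^esub> z = x \<otimes>\<^bsub>?G\<^esub> (y \<otimes>\<^bsub>?G\<^esub> z)"
    if "x \<in> carrier ?G" "y \<in> carrier ?G" "z \<in> carrier ?G" for x y z
    using that by (auto simp: carrier_presented_group presented_group_mult_class)
  show "\<one>\<^bsub>?G\<^esub> \<otimes>\<^bsub>?G\<^esub> x = x" if "x \<in> carrier ?G" for x
    using that by (auto simp: one carrier_presented_group presented_group_mult_class)
  show "\<exists>y\<in>carrier ?G. y \<otimes>\<^bsub>?G\<^esub> x = \<one>\<^bsub>?G\<^esub>" if x: "x \<in> carrier ?G" for x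
  proof -
    obtain u where u: "x = ?c u"
      using x by (auto simp: carrier_presented_group)
    let ?v = "rev (map (\<lambda>(x, e). (x, \<not> e)) u)"
    have "?c (?v @ u) = ?c []"
      using word_eq_inverse[of R u] by (blast intro: word_eq.trans word_eq.sym)
    then have "?c ?v \<otimes>\<^bsub>?G\<^esub> x = \<one>\<^bsub>?G\<^esub>"
      by (simp only: u one presented_group_mult_class)
    then show ?thesis
      by (intro bexI[of _ "?c ?v"]) (auto simp: carrier_presented_group)
  qed
qed

lemma equiv_conjugacy_rel:
  assumes "group G"
  shows "equiv (carrier G) (conjugacy_rel G)"
proof (rule equivI)
  interpret group G by fact
  show "conjugacy_rel G \<subseteq> carrier G \<times> carrier G"
    by (auto simp: conjugacy_rel_def)
  show "refl_on (carrier G) (conjugacy_rel G)"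
    by (auto simp: refl_on_def conjugacy_rel_def intro!: bexI[of _ "\<one>\<^bsub>G\<^esub>"])
  show "sym (conjugacy_rel G)"
  proof (rule symI)
    fix g h assume "(g, h) \<in> conjugacy_rel G"
    then obtain x where x: "g \<in> carrier G" "h \<in> carrier G" "x \<in> carrier G"
        "h = x \<otimes>\<^bsub>G\<^esub> g \<otimes>\<^bsub>G\<^esub> inv\<^bsub>G\<^esub> x"
      by (auto simp: conjugacy_rel_def)
    then have "g = inv\<^bsub>G\<^esub> x \<otimes>\<^bsub>G\<^esub> h \<otimes>\<^bsub>G\<^esub> inv\<^bsub>G\<^esub> (inv\<^bsub>G\<^esub> x)"
      by (simp add: m_assoc inv_solve_left)
    then show "(h, g) \<in> conjugacy_rel G"
      using x unfolding conjugacy_rel_def by blast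
  qed
  show "trans (conjugacy_rel G)"
  proof (rule transI)
    fix g h k assume "(g, h) \<in> conjugacy_rel G" "(h, k) \<in> conjugacy_rel G"
    then obtain x y where x: "g \<in> carrier G" "k \<in> carrier G" "x \<in> carrier G" "y \<in> carrier G"
        "k = y \<otimes>\<^bsub>G\<^esub> (x \<otimes>\<^bsub>G\<^esub> g \<otimes>\<^bsub>G\<^esub> inv\<^bsub>G\<^esub> x) \<otimes>\<^bsub>G\<^esub> inv\<^bsub>G\<^esub> y"
      by (auto simp: conjugacy_rel_def)
    then have "k = (y \<otimes>\<^bsub>G\<^esub> x) \<otimes>\<^bsub>G\<^esub> g \<otimes>\<^bsub>G\<^esub> inv\<^bsub>G\<^esub> (y \<otimes>\<^bsub>G\<^esub> x)"
      by (simp add: m_assoc inv_mult_group)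
    then show "(g, k) \<in> conjugacy_rel G"
      using x unfolding conjugacy_rel_def by blast
  qed
qed

lemma equiv_same_order_rel: "equiv (carrier G) (same_order_rel G)"
  by (rule equivI) (auto simp: refl_on_def sym_def trans_def same_order_rel_def)

end

theory Submission
  imports Defs
begin

text \<open>All three graphs have the same shape. Write \<open>R\<close> for the \<open>n\<close> rotations and \<open>Q\<close> for the
  \<open>n\<close> reflections. There is a set \<open>C \<subseteq> R\<close> of vertices adjacent to everything, \<open>R\<close> is a clique, the
  rotations outside \<open>C\<close> have no neighbours in \<open>Q\<close>, and \<open>Q\<close> is a disjoint union of cliques of one
  size \<open>k\<close>. In other words the graph is the join of \<open>K\<^sub>c\<close> with the disjoint union of \<open>K\<^sub>n\<^sub>-\<^sub>c\<close> and \<open>n/k\<close>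
  copies of \<open>K\<^sub>k\<close>, where \<open>c = |C|\<close>. The values of \<open>(c, k)\<close> are \<open>(1, 1)\<close> or \<open>(2, 2)\<close> for the commuting
  graph, \<open>(1, n)\<close>, \<open>(2, n/2)\<close> or \<open>(2, n)\<close> for conjugacy, and \<open>(1, n)\<close> or \<open>(n, n)\<close> for equal order,
  depending on \<open>n\<close> modulo \<open>4\<close>.

  For such a join the vertices of \<open>C\<close>, \<open>R - C\<close> and \<open>Q\<close> have the degrees \<open>2n - 1\<close>, \<open>n - 1\<close> and
  \<open>c + k - 1\<close>, and double counting expresses \<open>2|e|\<close>, \<open>M\<^sub>1\<close> and \<open>2M\<^sub>2\<close> as polynomials in \<open>n\<close>, \<open>c\<close>, \<open>k\<close>.
  With \<open>p = n - c\<close> and \<open>j = n - k\<close> one finds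
  \<open>2n \<cdot> 2M\<^sub>2 - 2|e| \<cdot> M\<^sub>1 = n\<^sup>2 (p c (4(n - 1) - 2p - 3j) + j\<^sup>2 (2(n - 1) - j))\<close>,
  and this is nonnegative for all integers \<open>1 \<le> c \<le> n\<close> and \<open>1 \<le> k \<le> n\<close>
  (\<open>clique_join_bound\<close>, \<open>Hansen_Vukicevic_clique_join\<close>), so no case distinction on the three graphs
  is needed at this stage.

  To see the shape, the presented group is identified with the pairs \<open>(e, t)\<close> of a truth value and
  an integer modulo \<open>n\<close>, standing for \<open>a\<^sup>t b\<^sup>e\<close> (\<open>word_eq_iff_same_value\<close>). Both \<open>C\<close> and the
  cliques in \<open>Q\<close> are then given by congruences modulo divisors \<open>q\<close> and \<open>m\<close> of \<open>n\<close>, with \<open>c = n/q\<close> and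
  \<open>k = n/m\<close> (\<open>Hansen_Vukicevic_dihedral\<close>), and it remains to read off \<open>q\<close> and \<open>m\<close> for the three
  relations.\<close>

section \<open>Sums over the edges of a simple graph\<close>

definition neighbours :: "'v ugraph \<Rightarrow> 'v \<Rightarrow> 'v set" where
  "neighbours \<Gamma> v = {u. u \<noteq> v \<and> {v, u} \<in> edges \<Gamma>}"

definition simple_graph :: "'v ugraph \<Rightarrow> bool" where
  "simple_graph \<Gamma> \<longleftrightarrow> finite (verts \<Gamma>) \<and>
     (\<forall>e\<in>edges \<Gamma>. \<exists>u\<in>verts \<Gamma>. \<exists>v\<in>verts \<Gamma>. u \<noteq> v \<and> e = {u, v})"

lemma simple_graph_edgeD:
  assumes "simple_graph \<Gamma>" and "{v, u} \<in> edges \<Gamma>"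
  shows "v \<in> verts \<Gamma>" "u \<in> verts \<Gamma>" "u \<noteq> v"
  using assms unfolding simple_graph_def by (metis doubleton_eq_iff)+

lemma simple_graph_finite:
  assumes "simple_graph \<Gamma>"
  shows "finite (verts \<Gamma>)" "finite (edges \<Gamma>)" "neighbours \<Gamma> v \<subseteq> verts \<Gamma>" "finite (neighbours \<Gamma> v)"
proof -
  show 1: "finite (verts \<Gamma>)" using assms by (simp add: simple_graph_def)
  have "edges \<Gamma> \<subseteq> Pow (verts \<Gamma>)" using assms by (auto simp: simple_graph_def)
  then show "finite (edges \<Gamma>)" using 1 by (meson finite_Pow_iff finite_subset)
  show 2: "neighbours \<Gamma> v \<subseteq> verts \<Gamma>"
    unfolding neighbours_def using simple_graph_edgeD(2)[OF assms] by blast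
  show "finite (neighbours \<Gamma> v)" using 1 2 by (rule finite_subset[rotated])
qed

lemma degree_eq_card_neighbours:
  assumes "simple_graph \<Gamma>"
  shows "degree \<Gamma> v = card (neighbours \<Gamma> v)"
proof -
  have "e \<in> (\<lambda>u. {v, u}) ` neighbours \<Gamma> v" if "e \<in> edges \<Gamma>" "v \<in> e" for e
  proof -
    obtain x y where "e = {x, y}" using assms \<open>e \<in> edges \<Gamma>\<close> unfolding simple_graph_def by blast
    then obtain u where "e = {v, u}" using \<open>v \<in> e\<close> by blast
    then show ?thesis
      using that simple_graph_edgeD(3)[OF assms, of v u] by (simp add: neighbours_def)
  qed
  then have "{e \<in> edges \<Gamma>. v \<in> e} = (\<lambda>u. {v, u}) ` neighbours \<Gamma> v"
    unfolding neighbours_def by blast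
  moreover have "inj_on (\<lambda>u. {v, u}) (neighbours \<Gamma> v)"
    by (auto simp: inj_on_def doubleton_eq_iff)
  ultimately show ?thesis by (simp add: degree_def card_image)
qed

text \<open>Double counting of arcs. With \<open>h = 1\<close> this is the handshake lemma, and with \<open>h\<close> the product
  of the end degrees it turns \<open>zagreb2\<close> into a sum over vertices.\<close>

lemma sum_neighbours_eq_twice_sum_edges:
  fixes h :: "'v set \<Rightarrow> nat"
  assumes "simple_graph \<Gamma>"
  shows "(\<Sum>v\<in>verts \<Gamma>. \<Sum>u\<in>neighbours \<Gamma> v. h {v, u}) = 2 * (\<Sum>e\<in>edges \<Gamma>. h e)"
proof -
  note fin = simple_graph_finite[OF assms]
  let ?A = "Sigma (verts \<Gamma>) (neighbours \<Gamma>)"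
  let ?g = "\<lambda>(v, u). {v, u}"
  \<comment> \<open>Group the arcs by their underlying edge; every fibre consists of two opposite arcs.\<close>
  have "(\<Sum>v\<in>verts \<Gamma>. \<Sum>u\<in>neighbours \<Gamma> v. h {v, u}) = (\<Sum>a\<in>?A. h (?g a))"
    using fin by (subst sum.Sigma) (auto simp: case_prod_beta)
  also have "\<dots> = (\<Sum>e\<in>edges \<Gamma>. \<Sum>a | a \<in> ?A \<and> ?g a = e. h (?g a))"
    using fin by (intro sum.group[symmetric] finite_SigmaI) (auto simp: neighbours_def)
  also have "\<dots> = (\<Sum>e\<in>edges \<Gamma>. 2 * h e)"
  proof (rule sum.cong[OF HOL.refl])
    fix e assume e: "e \<in> edges \<Gamma>"
    then obtain u v where uv: "u \<in> verts \<Gamma>" "v \<in> verts \<Gamma>" "u \<noteq> v" "e = {u, v}"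
      using assms by (auto simp: simple_graph_def)
    have "{a. a \<in> ?A \<and> ?g a = e} = {(u, v), (v, u)}"
    proof (intro equalityI subsetI)
      fix a assume "a \<in> {a. a \<in> ?A \<and> ?g a = e}"
      then show "a \<in> {(u, v), (v, u)}"
        using uv by (cases a) (simp add: doubleton_eq_iff)
    next
      fix a assume a: "a \<in> {(u, v), (v, u)}"
      have "{u, v} \<in> edges \<Gamma>" "{v, u} \<in> edges \<Gamma>" "{v, u} = e"
        using e uv by (simp_all add: insert_commute)
      then show "a \<in> {a. a \<in> ?A \<and> ?g a = e}"
        using a uv by (auto simp: neighbours_def)
    qed
    moreover have "{v, u} = e" using uv by blast
    ultimately show "(\<Sum>a | a \<in> ?A \<and> ?g a = e. h (?g a)) = 2 * h e"
      using uv by simp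
  qed
  finally show ?thesis by (simp add: sum_distrib_left)
qed

section \<open>The inequality for joins of cliques\<close>

text \<open>The Hansen--Vukicevic inequality for the join of \<open>K\<^sub>c\<close> with \<open>K\<^sub>p\<close> and \<open>n/k\<close> copies of \<open>K\<^sub>k\<close>, cleared
  of denominators: \<open>x\<close>, \<open>y\<close>, \<open>z\<close> are the three degrees, the left-hand side is \<open>2|e| \<cdot> M\<^sub>1\<close> and the
  right-hand side \<open>2n \<cdot> 2M\<^sub>2\<close>. Their difference is \<open>n\<^sup>2 (p c (4m - 2p - 3j) + j\<^sup>2 (2m - j))\<close> with \<open>m = n - 1\<close> and
  \<open>j = n - k\<close>, and its sign is clear unless \<open>t = 2p + 3j - 4m\<close> is positive. Then, in terms of the
  distances \<open>a = m - p = c - 1\<close> and \<open>b = m - j\<close> one has \<open>t = M - 2a\<close> with \<open>M = m - 3b\<close>, and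
  \<open>p c t \<le> m M\<^sup>2 \<le> (m + b) (m - b)\<^sup>2 = j\<^sup>2 (2m - j)\<close>. The first of these estimates uses \<open>M \<ge> 1\<close>,
  which is where integrality enters.\<close>

lemma clique_join_bound:
  fixes n c p k :: int
  assumes n: "n = c + p" and c: "c \<ge> 1" and p: "p \<ge> 0" and k: "k \<ge> 1" "k \<le> n"
  defines "x \<equiv> 2 * n - 1" and "y \<equiv> n - 1" and "z \<equiv> c + k - 1"
  shows "(c * x + p * y + n * z) * (c * x\<^sup>2 + p * y\<^sup>2 + n * z\<^sup>2)
    \<le> 2 * n * (c * (x * (c * x + p * y + n * z - x)) + p * (y * (c * x + p * y - y))
        + n * (z * (c * x + k * z - z)))"
proof -
  define m j where "m = n - 1" and "j = n - k"
  have j: "0 \<le> j" "j \<le> m" and pm: "p \<le> m" using k c n by (auto simp: m_def j_def)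
  have pos: "0 \<le> p * c * (4 * m - 2 * p - 3 * j) + j\<^sup>2 * (2 * m - j)"
  proof (cases "4 * m - 2 * p - 3 * j \<ge> 0")
    case True
    then show ?thesis using j c p by simp
  next
    case False
    define a b M where "a = m - p" and "b = m - j" and "M = m - 3 * b"
    have ab: "0 \<le> a" "0 \<le> b" "2 * a < M" "1 \<le> M" "c = a + 1" "p = m - a" "j = m - b"
      using False j pm n c by (auto simp: a_def b_def M_def m_def)
    have eq: "4 * m - 2 * p - 3 * j = - (M - 2 * a)"
      by (simp add: a_def b_def M_def)
    have "a * (M - 2 - 2 * a) \<le> a * (M - 1)"
      using ab by (intro mult_left_mono) auto
    also have "\<dots> \<le> M * (M - 1)"
      using ab by (intro mult_right_mono) auto
    \<comment> \<open>Since \<open>c = a + 1\<close>, the left-hand side is \<open>M + a (M - 2 - 2 a)\<close>.\<close>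
    finally have "c * (M - 2 * a) \<le> M * M"
      using ab by (simp add: algebra_simps)
    then have "p * (c * (M - 2 * a)) \<le> m * (M * M)"
      using ab pm p by (intro mult_mono) auto
    also have "m * (M * M) \<le> (m + b) * ((m - b) * (m - b))"
      using ab j by (intro mult_mono) (auto simp: M_def)
    also have "\<dots> = j\<^sup>2 * (2 * m - j)"
      by (simp add: ab power2_eq_square)
    finally show ?thesis unfolding eq by (simp only: mult.assoc mult_minus_right)
  qed
  have "2 * n * (c * (x * (c * x + p * y + n * z - x)) + p * (y * (c * x + p * y - y))
        + n * (z * (c * x + k * z - z)))
      - (c * x + p * y + n * z) * (c * x\<^sup>2 + p * y\<^sup>2 + n * z\<^sup>2)
    = n\<^sup>2 * (p * c * (4 * m - 2 * p - 3 * j) + j\<^sup>2 * (2 * m - j))"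
    unfolding x_def y_def z_def m_def j_def n by (simp add: algebra_simps power2_eq_square)
  also have "\<dots> \<ge> 0" using pos by simp
  finally show ?thesis by simp
qed

text \<open>The graph-theoretic form of \<open>clique_join_bound\<close>: \<open>K v\<close> is the clique of \<open>v\<close> inside \<open>Q\<close>. Only the
  neighbourhoods matter, because \<open>|e|\<close>, \<open>M\<^sub>1\<close> and \<open>M\<^sub>2\<close> are sums over vertices and their
  neighbours.\<close>

lemma Hansen_Vukicevic_clique_join:
  fixes \<Gamma> :: "'v ugraph" and n k :: nat
  assumes sg: "simple_graph \<Gamma>"
    and V: "verts \<Gamma> = C \<union> P \<union> Q" and disj: "C \<inter> P = {}" "C \<inter> Q = {}" "P \<inter> Q = {}"
    and C: "card C \<ge> 1" and CP: "card C + card P = n" and Q: "card Q = n" and k: "k \<ge> 1" "k \<le> n"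
    and nC: "\<And>v. v \<in> C \<Longrightarrow> neighbours \<Gamma> v = verts \<Gamma> - {v}"
    and nP: "\<And>v. v \<in> P \<Longrightarrow> neighbours \<Gamma> v = C \<union> P - {v}"
    and nQ: "\<And>v. v \<in> Q \<Longrightarrow> neighbours \<Gamma> v = C \<union> K v - {v}"
    and K: "\<And>v. v \<in> Q \<Longrightarrow> K v \<subseteq> Q \<and> v \<in> K v \<and> card (K v) = k"
  shows "real (zagreb2 \<Gamma>) / real (card (edges \<Gamma>)) \<ge> real (zagreb1 \<Gamma>) / real (card (verts \<Gamma>))"
proof -
  have fin: "finite C" "finite P" "finite Q" and finK: "v \<in> Q \<Longrightarrow> finite (K v)" for v
    using simple_graph_finite(1)[OF sg] K finite_subset[of "K v" Q] unfolding V by auto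
  define c p where "c = int (card C)" and "p = int (card P)"
  define x y z where "x = 2 * int n - 1" and "y = int n - 1" and "z = c + int k - 1"
  define d where "d v = int (degree \<Gamma> v)" for v
  have cp: "int n = c + p" using CP by (simp add: c_def p_def)
  have cardV: "card (verts \<Gamma>) = 2 * n"
    using fin disj CP Q by (simp add: V card_Un_disjoint Int_Un_distrib2)
  have split: "sum f (verts \<Gamma>) = sum f C + sum f P + sum f Q" for f :: "'v \<Rightarrow> int"
    using fin disj by (simp add: V sum.union_disjoint Int_Un_distrib2)
  have splitCP: "sum f (C \<union> P) = sum f C + sum f P" for f :: "'v \<Rightarrow> int"
    using fin disj by (subst sum.union_disjoint) auto
  have splitK: "v \<in> Q \<Longrightarrow> sum f (C \<union> K v) = sum f C + sum f (K v)" for f :: "'v \<Rightarrow> int" and v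
    using fin disj finK[of v] K[of v] by (subst sum.union_disjoint) auto
  have sumC: "sum f (neighbours \<Gamma> v) = sum f C + sum f P + sum f Q - f v"
    if "v \<in> C" for f :: "'v \<Rightarrow> int" and v
  proof -
    have "v \<in> verts \<Gamma>" using that V by blast
    then show ?thesis
      using simple_graph_finite(1)[OF sg] by (simp add: nC[OF that] sum_diff1 split)
  qed
  have sumP: "sum f (neighbours \<Gamma> v) = sum f C + sum f P - f v"
    if "v \<in> P" for f :: "'v \<Rightarrow> int" and v
    using that fin by (simp add: nP sum_diff1 splitCP)
  have sumQ: "sum f (neighbours \<Gamma> v) = sum f C + sum f (K v) - f v"
    if "v \<in> Q" for f :: "'v \<Rightarrow> int" and v
    using that fin finK[OF that] K[OF that] by (simp add: nQ sum_diff1 splitK)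
  have dC: "d v = x" if "v \<in> C" for v
    using sumC[OF that, of "\<lambda>_. 1"] CP Q
    by (simp add: d_def degree_eq_card_neighbours[OF sg] x_def)
  have dP: "d v = y" if "v \<in> P" for v
    using sumP[OF that, of "\<lambda>_. 1"] CP
    by (simp add: d_def degree_eq_card_neighbours[OF sg] y_def)
  have dQ: "d v = z" if "v \<in> Q" for v
    using sumQ[OF that, of "\<lambda>_. 1"] K[OF that]
    by (simp add: d_def degree_eq_card_neighbours[OF sg] z_def c_def)
  have dK: "sum d (K v) = int k * z" if "v \<in> Q" for v
    using sum.cong[OF HOL.refl, of "K v" d "\<lambda>_. z"] K[OF that] dQ by (auto simp: subset_iff)
  note ds = dC dP dQ dK c_def[symmetric] p_def[symmetric] Q
  have m: "2 * int (card (edges \<Gamma>)) = c * x + p * y + int n * z"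
  proof -
    have "2 * int (card (edges \<Gamma>)) = (\<Sum>v\<in>verts \<Gamma>. d v)"
      using arg_cong[OF sum_neighbours_eq_twice_sum_edges[OF sg, of "\<lambda>_. 1"], of int]
      by (simp add: d_def degree_eq_card_neighbours[OF sg])
    then show ?thesis by (simp add: split ds)
  qed
  have M1: "int (zagreb1 \<Gamma>) = c * x\<^sup>2 + p * y\<^sup>2 + int n * z\<^sup>2"
  proof -
    have "int (zagreb1 \<Gamma>) = (\<Sum>v\<in>verts \<Gamma>. (d v)\<^sup>2)"
      by (simp add: zagreb1_def d_def)
    then show ?thesis by (simp add: split ds)
  qed
  have M2: "2 * int (zagreb2 \<Gamma>) = c * (x * (c * x + p * y + int n * z - x))
      + p * (y * (c * x + p * y - y)) + int n * (z * (c * x + int k * z - z))"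
  proof -
    have "2 * zagreb2 \<Gamma> = (\<Sum>v\<in>verts \<Gamma>. \<Sum>u\<in>neighbours \<Gamma> v. degree \<Gamma> v * degree \<Gamma> u)"
      unfolding zagreb2_def sum_neighbours_eq_twice_sum_edges[OF sg, symmetric]
      by (intro sum.cong HOL.refl) (auto simp: neighbours_def)
    then have "2 * int (zagreb2 \<Gamma>) = (\<Sum>v\<in>verts \<Gamma>. d v * (\<Sum>u\<in>neighbours \<Gamma> v. d u))"
      by (simp add: d_def sum_distrib_left flip: of_nat_mult of_nat_sum) 
    then show ?thesis by (simp add: split sumC sumP sumQ ds)
  qed
  have "(2 * int (card (edges \<Gamma>))) * int (zagreb1 \<Gamma>) \<le> (2 * int n) * (2 * int (zagreb2 \<Gamma>))"
    unfolding m M1 M2 x_def y_def z_def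
    using clique_join_bound[of "int n" c p "int k"] cp C k by (simp add: c_def p_def)
  then have "int (card (edges \<Gamma>) * zagreb1 \<Gamma>) \<le> int (2 * n * zagreb2 \<Gamma>)"
    by (simp add: mult_ac)
  then have le: "real (card (edges \<Gamma>)) * real (zagreb1 \<Gamma>) \<le> real (2 * n) * real (zagreb2 \<Gamma>)"
    by (simp only: of_nat_le_iff of_nat_mult[symmetric])
  \<comment> \<open>The denominator \<open>|e|\<close> is nonzero, as \<open>C\<close> is nonempty.\<close>
  have "c * x > 0" "p * y \<ge> 0" "int n * z \<ge> 0"
    using C k cp by (auto simp: x_def y_def z_def c_def p_def)
  with m have "card (edges \<Gamma>) > 0" by linarith
  then show ?thesis
    using le k by (simp add: cardV field_simps)
qed

section \<open>Words in the dihedral generators\<close>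

text \<open>A word \<open>w\<close> evaluates to \<open>a\<^sup>t b\<^sup>e\<close>, where \<open>e\<close> is the parity of the number of letters \<open>b\<close> and \<open>t\<close>
  is an integer computed with the rule \<open>b a\<^sup>t = a\<^sup>-\<^sup>t b\<close>. These two functions evaluate in the infinite
  dihedral group; the relation \<open>a\<^sup>n = 1\<close> is imposed later by taking \<open>t\<close> modulo \<open>n\<close>.\<close>

fun word_reflects :: "dihedral_gen word \<Rightarrow> bool" where
  "word_reflects [] = False"
| "word_reflects ((gen_a, e) # w) = word_reflects w"
| "word_reflects ((gen_b, e) # w) = (\<not> word_reflects w)"

fun word_rotation :: "dihedral_gen word \<Rightarrow> int" where
  "word_rotation [] = 0"
| "word_rotation ((gen_a, e) # w) = (if e then 1 else -1) + word_rotation w"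
| "word_rotation ((gen_b, e) # w) = - word_rotation w"

lemma word_reflects_append: "word_reflects (u @ v) \<longleftrightarrow> word_reflects u \<noteq> word_reflects v"
  by (induction u rule: word_reflects.induct) auto

lemma word_rotation_append:
  "word_rotation (u @ v) =
     word_rotation u + (if word_reflects u then - word_rotation v else word_rotation v)"
  by (induction u rule: word_reflects.induct) auto

lemma word_reflects_replicate [simp]: "\<not> word_reflects (replicate k (gen_a, True))"
  by (induction k) auto

lemma word_rotation_replicate [simp]: "word_rotation (replicate k (gen_a, True)) = int k"
  by (induction k) auto

text \<open>Every defining relation holds in the model, so the model is a quotient of the presented group.
  This is what keeps the \<open>2n\<close> elements distinct.\<close>

lemma word_eq_imp_same_value:
  assumes "word_eq (dihedral_relations n) u v"
  shows "word_reflects u = word_reflects v \<and> int n dvd word_rotation u - word_rotation v"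
  using assms
proof (induction rule: word_eq.induct)
  case (relation u v)
  then show ?case by (auto simp: dihedral_relations_def)
next
  case (cancel x e)
  then show ?case by (cases x) auto
next
  case (append u u' v v')
  have eq: "word_rotation (u @ v) - word_rotation (u' @ v') = (word_rotation u - word_rotation u')
      + (if word_reflects u then -1 else 1) * (word_rotation v - word_rotation v')"
    using append.IH by (simp add: word_rotation_append)
  have "int n dvd word_rotation (u @ v) - word_rotation (u' @ v')"
    unfolding eq using append.IH by (intro dvd_add dvd_mult) auto
  then show ?case
    using append.IH by (simp add: word_reflects_append)
next
  case (sym u v)
  then show ?case by (simp add: dvd_diff_commute)
next
  case (trans u v w)
  then have "int n dvd (word_rotation u - word_rotation v) + (word_rotation v - word_rotation w)"
    by (intro dvd_add) auto
  with trans show ?case by simp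
qed simp

definition normal_word :: "bool \<Rightarrow> nat \<Rightarrow> dihedral_gen word" where
  "normal_word e k = replicate k (gen_a, True) @ (if e then [(gen_b, True)] else [])"

lemma word_eq_in_context: "word_eq R u v \<Longrightarrow> word_eq R (x @ u @ y) (x @ v @ y)"
  by (intro word_eq.append word_eq.refl)

lemma word_eq_cancel_in_context: "word_eq R (x @ [(g, False), (g, True)] @ y) (x @ [] @ y)"
  using word_eq.cancel[of R g False] by (intro word_eq_in_context) simp

context
  fixes n :: nat
  assumes n: "n \<ge> 1"
begin

abbreviation word_equiv :: "dihedral_gen word \<Rightarrow> dihedral_gen word \<Rightarrow> bool" (infix "\<approx>" 50) where
  "u \<approx> v \<equiv> word_eq (dihedral_relations n) u v"

lemma gen_a_power: "replicate n (gen_a, True) \<approx> []"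
  by (rule word_eq.relation) (simp add: dihedral_relations_def)

lemma gen_a_inverse: "[(gen_a, False)] \<approx> replicate (n - 1) (gen_a, True)"
proof -
  have "[(gen_a, False)] @ replicate n (gen_a, True) @ [] \<approx> [(gen_a, False)] @ [] @ []"
    by (rule word_eq_in_context[OF gen_a_power])
  moreover have "replicate n (gen_a, True) = (gen_a, True) # replicate (n - 1) (gen_a, True)"
    using n by (cases n) auto
  moreover have "[] @ [(gen_a, False), (gen_a, True)] @ replicate (n - 1) (gen_a, True)
      \<approx> [] @ [] @ replicate (n - 1) (gen_a, True)"
    by (rule word_eq_cancel_in_context)
  ultimately show ?thesis
    by (auto intro: word_eq.trans word_eq.sym)
qed

lemma gen_b_square: "[(gen_b, True), (gen_b, True)] \<approx> []"
  by (rule word_eq.relation) (simp add: dihedral_relations_def)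

lemma gen_b_inverse: "[(gen_b, False)] \<approx> [(gen_b, True)]"
proof -
  have "[(gen_b, False)] @ [(gen_b, True), (gen_b, True)] @ [] \<approx> [(gen_b, False)] @ [] @ []"
    by (rule word_eq_in_context[OF gen_b_square])
  moreover have "[] @ [(gen_b, False), (gen_b, True)] @ [(gen_b, True)] \<approx> [] @ [] @ [(gen_b, True)]"
    by (rule word_eq_cancel_in_context)
  ultimately show ?thesis
    by (auto intro: word_eq.trans word_eq.sym)
qed

lemma gen_b_gen_a:
  "[(gen_b, True), (gen_a, True)] \<approx> replicate (n - 1) (gen_a, True) @ [(gen_b, True)]"
proof -
  have "[(gen_b, True), (gen_a, True)] @ [(gen_b, False), (gen_b, True)] @ []
      \<approx> [(gen_b, True), (gen_a, True)] @ [] @ []"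
    by (rule word_eq_cancel_in_context)
  moreover have "[(gen_b, True), (gen_a, True), (gen_b, False)] \<approx> [(gen_a, False)]"
    by (rule word_eq.relation) (simp add: dihedral_relations_def)
  then have "[(gen_b, True), (gen_a, True), (gen_b, False)] \<approx> replicate (n - 1) (gen_a, True)"
    using gen_a_inverse word_eq.trans by blast
  then have "[] @ [(gen_b, True), (gen_a, True), (gen_b, False)] @ [(gen_b, True)]
      \<approx> [] @ replicate (n - 1) (gen_a, True) @ [(gen_b, True)]"
    by (rule word_eq_in_context)
  ultimately show ?thesis
    by (auto intro: word_eq.trans word_eq.sym)
qed

text \<open>It suffices that some exponent \<open>l\<close> exists: \<open>word_eq_imp_same_value\<close> then determines it
  modulo \<open>n\<close>.\<close>

lemma gen_b_gen_a_power:
  "\<exists>l. (gen_b, True) # replicate k (gen_a, True) \<approx> replicate l (gen_a, True) @ [(gen_b, True)]"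
proof (induction k)
  case 0
  show ?case by (rule exI[of _ 0]) (simp add: word_eq.refl)
next
  case (Suc k)
  then obtain l where l:
    "(gen_b, True) # replicate k (gen_a, True) \<approx> replicate l (gen_a, True) @ [(gen_b, True)]" by blast
  have "[] @ [(gen_b, True), (gen_a, True)] @ replicate k (gen_a, True)
     \<approx> [] @ (replicate (n - 1) (gen_a, True) @ [(gen_b, True)]) @ replicate k (gen_a, True)"
    by (rule word_eq_in_context[OF gen_b_gen_a])
  moreover have "replicate (n - 1) (gen_a, True) @ ((gen_b, True) # replicate k (gen_a, True)) @ []
     \<approx> replicate (n - 1) (gen_a, True) @ (replicate l (gen_a, True) @ [(gen_b, True)]) @ []"
    by (rule word_eq_in_context[OF l])
  ultimately have "(gen_b, True) # replicate (Suc k) (gen_a, True)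
     \<approx> replicate (n - 1 + l) (gen_a, True) @ [(gen_b, True)]"
    by (auto intro: word_eq.trans simp: replicate_add)
  then show ?case by blast
qed

lemma gen_b_normal_word: "\<exists>e' k'. [(gen_b, True)] @ normal_word e k \<approx> normal_word e' k'"
proof -
  let ?tail = "if e then [(gen_b, True)] else []"
  obtain l where "(gen_b, True) # replicate k (gen_a, True)
      \<approx> replicate l (gen_a, True) @ [(gen_b, True)]"
    using gen_b_gen_a_power by blast
  then have *: "[(gen_b, True)] @ normal_word e k
      \<approx> replicate l (gen_a, True) @ [(gen_b, True)] @ ?tail"
    using word_eq.append[OF _ word_eq.refl, of _ _ _ ?tail] by (fastforce simp: normal_word_def)
  show ?thesis
  proof (cases e)
    case True
    have "replicate l (gen_a, True) @ [(gen_b, True), (gen_b, True)] @ []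
        \<approx> replicate l (gen_a, True) @ [] @ []"
      by (rule word_eq_in_context[OF gen_b_square])
    with * True have "[(gen_b, True)] @ normal_word e k \<approx> normal_word False l"
      by (auto simp: normal_word_def intro: word_eq.trans)
    then show ?thesis by blast
  next
    case False
    with * have "[(gen_b, True)] @ normal_word e k \<approx> normal_word True l"
      by (simp add: normal_word_def)
    then show ?thesis by blast
  qed
qed

lemma word_eq_normal_word: "\<exists>e k. u \<approx> normal_word e k"
proof (induction u)
  case Nil
  show ?case
    by (rule exI[of _ False], rule exI[of _ 0]) (simp add: normal_word_def word_eq.refl)
next
  case (Cons l u)
  then obtain e k where "u \<approx> normal_word e k" by blast
  then have step: "[l] @ u \<approx> [l] @ normal_word e k"
    by (intro word_eq.append word_eq.refl)
  have letter: "\<exists>e' k'. [l] @ normal_word e k \<approx> normal_word e' k'"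
  proof -
    consider "l = (gen_a, True)" | "l = (gen_a, False)" | "l = (gen_b, True)" | "l = (gen_b, False)"
      by (metis (full_types) dihedral_gen.exhaust surj_pair)
    then show ?thesis
    proof cases
      case 1
      then have "[l] @ normal_word e k = normal_word e (Suc k)" by (simp add: normal_word_def)
      then show ?thesis by (metis word_eq.refl)
    next
      case 2
      have "[l] @ normal_word e k \<approx> replicate (n - 1) (gen_a, True) @ normal_word e k"
        unfolding 2 by (intro word_eq.append word_eq.refl gen_a_inverse)
      then have "[l] @ normal_word e k \<approx> normal_word e (n - 1 + k)"
        by (simp add: normal_word_def replicate_add)
      then show ?thesis by blast
    next
      case 3
      then show ?thesis using gen_b_normal_word by blast
    next
      case 4
      have "[l] @ normal_word e k \<approx> [(gen_b, True)] @ normal_word e k"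
        unfolding 4 by (intro word_eq.append word_eq.refl gen_b_inverse)
      then show ?thesis using gen_b_normal_word word_eq.trans by blast
    qed
  qed
  with step show ?case by (metis append_Cons append_Nil word_eq.trans)
qed

lemma gen_a_power_mod: "replicate (k mod n) (gen_a, True) \<approx> replicate k (gen_a, True)"
proof -
  have "replicate (n * q + r) (gen_a, True) \<approx> replicate r (gen_a, True)" for q r
  proof (induction q)
    case (Suc q)
    have "[] @ replicate n (gen_a, True) @ replicate (n * q + r) (gen_a, True)
        \<approx> [] @ [] @ replicate (n * q + r) (gen_a, True)"
      by (rule word_eq_in_context[OF gen_a_power])
    with Suc show ?case
      by (auto intro: word_eq.trans simp: replicate_add add.assoc)
  qed (simp add: word_eq.refl)
  from this[of "k div n" "k mod n"] show ?thesis
    by (simp add: word_eq.sym)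
qed

text \<open>The presentation describes the model exactly: two words with the same value have normal forms
  \<open>a\<^sup>k b\<^sup>e\<close> and \<open>a\<^sup>l b\<^sup>e\<close> with \<open>k \<equiv> l\<close> modulo \<open>n\<close>, and these agree because \<open>a\<^sup>n = 1\<close>.\<close>

lemma word_eq_iff_same_value:
  "u \<approx> v \<longleftrightarrow> word_reflects u = word_reflects v \<and> int n dvd word_rotation u - word_rotation v"
proof
  assume *: "word_reflects u = word_reflects v \<and> int n dvd word_rotation u - word_rotation v"
  obtain e k where u: "u \<approx> normal_word e k" using word_eq_normal_word by blast
  obtain f l where v: "v \<approx> normal_word f l" using word_eq_normal_word by blast
  have [simp]: "word_reflects (normal_word e k) = e" "word_rotation (normal_word e k) = int k" for e k
    by (auto simp: normal_word_def word_reflects_append word_rotation_append)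
  note uv = word_eq_imp_same_value[OF u] word_eq_imp_same_value[OF v]
  have ef: "e = f" using * uv by simp
  have "int n dvd (word_rotation u - word_rotation v) - (word_rotation u - int k)
      + (word_rotation v - int l)"
    using * uv by (intro dvd_add[OF dvd_diff]) auto
  then have "int k mod int n = int l mod int n"
    by (simp add: mod_eq_dvd_iff)
  then have "k mod n = l mod n"
    by (metis of_nat_eq_iff of_nat_mod)
  then have "replicate k (gen_a, True) \<approx> replicate l (gen_a, True)"
    using gen_a_power_mod[of k] gen_a_power_mod[of l] by (metis word_eq.sym word_eq.trans)
  then have "normal_word e k \<approx> normal_word f l"
    unfolding normal_word_def ef by (intro word_eq.append word_eq.refl)
  then show "u \<approx> v"
    using u v word_eq.sym word_eq.trans by blast
qed (rule word_eq_imp_same_value)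
end

section \<open>The elements of the dihedral group\<close>

text \<open>The element \<open>a\<^sup>t b\<^sup>e\<close>, as an equivalence class of words. An integer exponent spares the
  reduction modulo \<open>n\<close> in products and inverses.\<close>

definition dihedral_elt :: "nat \<Rightarrow> bool \<Rightarrow> int \<Rightarrow> dihedral_gen word set" where
  "dihedral_elt n e t = {w. word_reflects w = e \<and> int n dvd t - word_rotation w}"

lemma class_eq_dihedral_elt:
  assumes "n \<ge> 1"
  shows "{w. word_eq (dihedral_relations n) u w} = dihedral_elt n (word_reflects u) (word_rotation u)"
  by (auto simp: dihedral_elt_def word_eq_iff_same_value[OF assms])

lemma dihedral_elt_eq_iff:
  "dihedral_elt n e s = dihedral_elt n f t \<longleftrightarrow> e = f \<and> int n dvd s - t"
  if n: "n \<ge> 1"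
proof
  define w where "w = normal_word e (nat (s mod int n))"
  have "word_reflects w = e" "word_rotation w = s mod int n"
    using n by (auto simp: w_def normal_word_def word_reflects_append word_rotation_append)
  moreover assume "dihedral_elt n e s = dihedral_elt n f t"
  moreover have "w \<in> dihedral_elt n e s"
    using calculation(1,2) by (simp add: dihedral_elt_def)
  ultimately have "w \<in> dihedral_elt n f t" by simp
  then have "e = f" "int n dvd t - s mod int n"
    using \<open>word_reflects w = e\<close> \<open>word_rotation w = s mod int n\<close> by (auto simp: dihedral_elt_def)
  then show "e = f \<and> int n dvd s - t"
    by (simp add: mod_eq_dvd_iff[symmetric] eq_commute)
next
  assume *: "e = f \<and> int n dvd s - t"
  have "int n dvd s - x \<longleftrightarrow> int n dvd t - x" for x
    using * dvd_add_right_iff[of "int n" "s - t" "t - x"] by simp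
  then show "dihedral_elt n e s = dihedral_elt n f t"
    using * by (simp add: dihedral_elt_def)
qed

lemma dihedral_elt_class:
  assumes n: "n \<ge> 1"
  obtains u where "dihedral_elt n e t = {w. word_eq (dihedral_relations n) u w}"
    and "word_reflects u = e" and "word_rotation u = t mod int n"
proof
  define u where "u = normal_word e (nat (t mod int n))"
  show u: "word_reflects u = e" "word_rotation u = t mod int n"
    using n by (auto simp: u_def normal_word_def word_reflects_append word_rotation_append)
  show "dihedral_elt n e t = {w. word_eq (dihedral_relations n) u w}"
    using n by (simp add: class_eq_dihedral_elt u dihedral_elt_eq_iff)
qed

lemma carrier_dihedral_group:
  assumes "n \<ge> 1"
  shows "g \<in> carrier (dihedral_group n) \<longleftrightarrow> (\<exists>e t. g = dihedral_elt n e t)"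
  unfolding dihedral_group_def carrier_presented_group
  by (metis (no_types, lifting) assms class_eq_dihedral_elt dihedral_elt_class image_iff rangeI)

lemma dihedral_elt_in_carrier [simp]:
  "n \<ge> 1 \<Longrightarrow> dihedral_elt n e t \<in> carrier (dihedral_group n)"
  by (auto simp: carrier_dihedral_group)

lemma group_dihedral_group: "group (dihedral_group n)"
  unfolding dihedral_group_def by (rule group_presented_group)

lemma dihedral_mult:
  assumes n: "n \<ge> 1"
  shows "dihedral_elt n e s \<otimes>\<^bsub>dihedral_group n\<^esub> dihedral_elt n f t
    = dihedral_elt n (e \<noteq> f) (s + (if e then - t else t))"
proof -
  obtain u where u: "dihedral_elt n e s = {w. word_eq (dihedral_relations n) u w}"
    "word_reflects u = e" "word_rotation u = s mod int n" by (rule dihedral_elt_class[OF n])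
  obtain v where v: "dihedral_elt n f t = {w. word_eq (dihedral_relations n) v w}"
    "word_reflects v = f" "word_rotation v = t mod int n" by (rule dihedral_elt_class[OF n])
  have "dihedral_elt n e s \<otimes>\<^bsub>dihedral_group n\<^esub> dihedral_elt n f t
      = {w. word_eq (dihedral_relations n) (u @ v) w}"
    unfolding dihedral_group_def u(1) v(1) by (rule presented_group_mult_class)
  also have "\<dots> = dihedral_elt n (e \<noteq> f) (s mod int n + (if e then - (t mod int n) else t mod int n))"
    by (simp add: class_eq_dihedral_elt[OF n] word_reflects_append word_rotation_append u(2,3) v(2,3))
  also have "\<dots> = dihedral_elt n (e \<noteq> f) (s + (if e then - t else t))"
    by (simp add: dihedral_elt_eq_iff[OF n] mod_simps flip: mod_eq_dvd_iff)
  finally show ?thesis .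
qed

lemma dihedral_one:
  assumes "n \<ge> 1"
  shows "\<one>\<^bsub>dihedral_group n\<^esub> = dihedral_elt n False 0"
  using class_eq_dihedral_elt[OF assms, of "[]"]
  by (simp add: dihedral_group_def presented_group_def)

lemma dihedral_inv:
  assumes "n \<ge> 1"
  shows "inv\<^bsub>dihedral_group n\<^esub> (dihedral_elt n e t) = dihedral_elt n e (if e then t else - t)"
  using assms by (intro group.inv_equality[OF group_dihedral_group])
    (simp_all add: dihedral_mult dihedral_one)

text \<open>With \<open>q = 1\<close> this counts all rotations or all reflections, and for other \<open>q\<close> it counts the
  universal vertices and the cliques of reflections.\<close>

lemma card_dihedral_elts:
  assumes n: "n \<ge> 1" and q: "q dvd n"
  shows "card (dihedral_elt n e ` {t. int q dvd t - s}) = n div q"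
proof -
  define k where "k = n div q"
  have nk: "n = q * k" and pos: "q > 0" "k > 0"
    using n q by (auto simp: k_def dvd_def)
  have "dihedral_elt n e ` {t. int q dvd t - s} = (\<lambda>j. dihedral_elt n e (s + int q * j)) ` {0..<int k}"
  proof (intro equalityI subsetI)
    fix g assume "g \<in> dihedral_elt n e ` {t. int q dvd t - s}"
    then obtain i where "g = dihedral_elt n e (s + int q * i)"
      by (auto simp: dvd_def) (metis add.commute diff_add_cancel)
    also have "\<dots> = dihedral_elt n e (s + int q * (i mod int k))"
      unfolding dihedral_elt_eq_iff[OF n]
      by (simp add: nk pos flip: right_diff_distrib) 
    finally show "g \<in> (\<lambda>j. dihedral_elt n e (s + int q * j)) ` {0..<int k}"
      using pos by auto
  qed auto
  moreover have "inj_on (\<lambda>j. dihedral_elt n e (s + int q * j)) {0..<int k}"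
  proof (rule inj_onI)
    fix i j assume ij: "i \<in> {0..<int k}" "j \<in> {0..<int k}"
      and "dihedral_elt n e (s + int q * i) = dihedral_elt n e (s + int q * j)"
    then have "int n dvd int q * (i - j)"
      by (simp add: dihedral_elt_eq_iff[OF n] right_diff_distrib)
    then have "int k dvd i - j"
      using pos by (simp add: nk)
    then show "i = j"
      using ij by (simp flip: mod_eq_dvd_iff)
  qed
  ultimately show ?thesis by (simp add: card_image k_def)
qed

section \<open>Super commuting graphs of the dihedral group\<close>

text \<open>The adjacency condition of \<open>super_commuting_graph\<close>, without the requirement that the two
  vertices be distinct.\<close>

definition super_adjacent :: "('a, 'm) monoid_scheme \<Rightarrow> ('a \<times> 'a) set \<Rightarrow> 'a \<Rightarrow> 'a \<Rightarrow> bool" where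
  "super_adjacent G B g h \<longleftrightarrow> B `` {g} = B `` {h} \<or>
     (\<exists>g'\<in>B `` {g}. \<exists>h'\<in>B `` {h}. g' \<otimes>\<^bsub>G\<^esub> h' = h' \<otimes>\<^bsub>G\<^esub> g')"

lemma super_adjacent_sym: "super_adjacent G B g h \<Longrightarrow> super_adjacent G B h g"
  unfolding super_adjacent_def by metis

lemma verts_super_commuting_graph [simp]: "verts (super_commuting_graph G B) = carrier G"
  by (simp add: super_commuting_graph_def)

lemma simple_super_commuting_graph:
  "finite (carrier G) \<Longrightarrow> simple_graph (super_commuting_graph G B)"
  by (auto simp: simple_graph_def super_commuting_graph_def)

lemma neighbours_super_commuting_graph:
  assumes "g \<in> carrier G"
  shows "neighbours (super_commuting_graph G B) g = {h \<in> carrier G. h \<noteq> g \<and> super_adjacent G B g h}"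
proof -
  have "edges (super_commuting_graph G B) =
      {{x, y} | x y. x \<in> carrier G \<and> y \<in> carrier G \<and> x \<noteq> y \<and> super_adjacent G B x y}"
    by (simp add: super_commuting_graph_def super_adjacent_def)
  then show ?thesis
    using assms super_adjacent_sym[of G B]
    unfolding neighbours_def by (auto simp: doubleton_eq_iff)
qed

text \<open>The common shape of the three graphs: a rotation \<open>a\<^sup>t\<close> is adjacent to reflections only if \<open>q\<close>
  divides \<open>t\<close>, and then to every vertex, while reflections are adjacent along the congruence
  modulo \<open>m\<close>.\<close>

lemma Hansen_Vukicevic_dihedral:
  assumes n: "n \<ge> 1" and q: "q dvd n" and m: "m dvd n"
    and adj: "\<And>e s f t. super_adjacent (dihedral_group n) B (dihedral_elt n e s) (dihedral_elt n f t) \<longleftrightarrow>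
      (if e then (if f then int m dvd t - s else int q dvd t) else (if f then int q dvd s else True))"
  defines "\<Gamma> \<equiv> super_commuting_graph (dihedral_group n) B"
  shows "real (zagreb2 \<Gamma>) / real (card (edges \<Gamma>)) \<ge> real (zagreb1 \<Gamma>) / real (card (verts \<Gamma>))"
proof -
  let ?G = "dihedral_group n"
  let ?elt = "dihedral_elt n"
  define C R Q where "C = ?elt False ` {t. int q dvd t}" and "R = range (?elt False)"
    and "Q = range (?elt True)"
  \<comment> \<open>The rotations whose neighbours are exactly the other rotations, and the cliques of reflections.\<close>
  define P where "P = R - C"
  define K where "K g = {h \<in> Q. super_adjacent ?G B g h}" for g
  note eq_iff = dihedral_elt_eq_iff[OF n]
  have cR: "card R = n" and cQ: "card Q = n" and cC: "card C = n div q"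
    using card_dihedral_elts[OF n, of 1 False 0] card_dihedral_elts[OF n, of 1 True 0]
      card_dihedral_elts[OF n q, of False 0] by (simp_all add: C_def R_def Q_def)
  have fin: "finite R" "finite Q" 
    using cR cQ n by (auto intro: card_ge_0_finite)
  have CR: "C \<subseteq> R" by (auto simp: C_def R_def)
  have V: "carrier ?G = C \<union> P \<union> Q"
  proof -
    have "carrier ?G = R \<union> Q"
      (is "?L = ?R")
    proof (intro equalityI subsetI)
      fix g assume "g \<in> ?L"
      then obtain e t where "g = ?elt e t" using carrier_dihedral_group[OF n] by blast
      then show "g \<in> ?R" by (cases e) (auto simp: R_def Q_def)
    qed (use n in \<open>auto simp: R_def Q_def\<close>)
    then show ?thesis using CR by (auto simp: P_def)
  qed
  have RQ: "R \<inter> Q = {}" by (auto simp: R_def Q_def eq_iff)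
  have memC: "?elt False t \<in> C \<longleftrightarrow> int q dvd t" for t
  proof
    assume "?elt False t \<in> C"
    then obtain s where "int q dvd s" "int n dvd t - s" by (auto simp: C_def eq_iff)
    moreover have "int q dvd int n" using q by simp
    ultimately show "int q dvd t" by (metis dvd_trans dvd_diffD diff_add_cancel dvd_add)
  qed (auto simp: C_def)
  have sg: "simple_graph \<Gamma>"
    unfolding \<Gamma>_def using fin CR V by (intro simple_super_commuting_graph) (simp add: P_def finite_subset)
  show ?thesis
  proof (rule Hansen_Vukicevic_clique_join[OF sg, where C = C and P = P and Q = Q and n = n and k = "n div m" and K = K])
    show "verts \<Gamma> = C \<union> P \<union> Q" using V by (simp add: \<Gamma>_def)
    show "C \<inter> P = {}" "C \<inter> Q = {}" "P \<inter> Q = {}" using RQ CR by (auto simp: P_def)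
    show "card C \<ge> 1" using n q by (auto simp: cC dvd_def)
    show "card C + card P = n"
      using card_mono[OF fin(1) CR] by (simp add: P_def card_Diff_subset[OF finite_subset[OF CR fin(1)] CR] cR)
    show "card Q = n" by (rule cQ)
    show "n div m \<ge> 1" using n m by (auto simp: dvd_def)
    show "n div m \<le> n" by simp
  next
    fix v assume "v \<in> C"
    then obtain t where v: "v = ?elt False t" "int q dvd t"
      using memC by (auto simp: C_def)
    have v': "v \<in> carrier ?G" using n v by simp
    have "super_adjacent ?G B v g" if "g \<in> carrier ?G" for g
      using that v(2) by (auto simp: v(1) carrier_dihedral_group[OF n] adj)
    then show "neighbours \<Gamma> v = verts \<Gamma> - {v}"
      by (auto simp: \<Gamma>_def neighbours_super_commuting_graph[OF v'])
  next
    fix v assume "v \<in> P"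
    then obtain t where v: "v = ?elt False t" "\<not> int q dvd t"
      using memC by (auto simp: P_def R_def)
    have v': "v \<in> carrier ?G" using n v by simp
    have "super_adjacent ?G B v g" if "g \<in> R" for g
      using that by (auto simp: v(1) R_def adj)
    moreover have "\<not> super_adjacent ?G B v g" if "g \<in> Q" for g
      using that v(2) by (auto simp: v(1) Q_def adj)
    ultimately show "neighbours \<Gamma> v = C \<union> P - {v}"
      unfolding \<Gamma>_def neighbours_super_commuting_graph[OF v'] V using CR by (auto simp: P_def)
  next
    fix v assume "v \<in> Q"
    then obtain s where v: "v = ?elt True s"
      by (auto simp: Q_def)
    have adjR: "super_adjacent ?G B v g \<longleftrightarrow> g \<in> C" if "g \<in> R" for g
    proof -
      from that obtain t where "g = ?elt False t" unfolding R_def by blast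
      then show ?thesis by (simp add: memC v adj)
    qed
    have v': "v \<in> carrier ?G" using n v by simp
    show "neighbours \<Gamma> v = C \<union> K v - {v}"
      unfolding \<Gamma>_def neighbours_super_commuting_graph[OF v'] V K_def
      using adjR CR by (auto simp: P_def)
    have "K v = ?elt True ` {t. int m dvd t - s}"
      unfolding K_def Q_def v using adj by auto
    then show "K v \<subseteq> Q \<and> v \<in> K v \<and> card (K v) = n div m"
      using card_dihedral_elts[OF n m] by (auto simp: Q_def v)
  qed
qed

section \<open>Adjacency for equality, conjugacy and equal order\<close>

text \<open>The period of \<open>2 x\<close> modulo \<open>n\<close>. It governs commutation: \<open>a\<^sup>s\<close> commutes with \<open>a\<^sup>t b\<close> iff
  \<open>a\<^sup>2\<^sup>s = 1\<close>, and two reflections commute iff the square of their product is \<open>1\<close>.\<close>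

definition half_period :: "nat \<Rightarrow> nat" where
  "half_period n = (if even n then n div 2 else n)"

lemma half_period_dvd: "half_period n dvd n"
  by (auto simp: half_period_def)

lemma dvd_double_iff: "int n dvd 2 * x \<longleftrightarrow> int (half_period n) dvd x"
proof (cases "even n")
  case True
  then obtain l where "n = 2 * l" by blast
  then show ?thesis by (simp add: half_period_def)
next
  case False
  then have "coprime (int n) 2" by simp
  then show ?thesis using False by (simp add: half_period_def coprime_dvd_mult_right_iff)
qed

lemma dihedral_commute_iff:
  assumes n: "n \<ge> 1"
  shows "dihedral_elt n e s \<otimes>\<^bsub>dihedral_group n\<^esub> dihedral_elt n f t
      = dihedral_elt n f t \<otimes>\<^bsub>dihedral_group n\<^esub> dihedral_elt n e s \<longleftrightarrow>
    (if e then int (half_period n) dvd (if f then t - s else t)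
     else if f then int (half_period n) dvd s else True)"
proof -
  have "s - t - (t - s) = 2 * (s - t)" "s - t - (t + s) = - (2 * t)" "s + t - (t - s) = 2 * s"
    by simp_all
  then show ?thesis
    using dvd_double_iff[of n "s - t"] dvd_double_iff[of n s] dvd_double_iff[of n t]
      dvd_diff_commute[of "int (half_period n)" s t]
    by (simp add: dihedral_mult[OF n] dihedral_elt_eq_iff[OF n])
qed

lemma ESCom_adjacent_iff:
  assumes n: "n \<ge> 1"
  shows "super_adjacent (dihedral_group n) (Id_on (carrier (dihedral_group n)))
      (dihedral_elt n e s) (dihedral_elt n f t) \<longleftrightarrow>
    (if e then (if f then int (half_period n) dvd t - s else int (half_period n) dvd t)
     else (if f then int (half_period n) dvd s else True))"
proof -
  have "Id_on (carrier (dihedral_group n)) `` {dihedral_elt n e t} = {dihedral_elt n e t}" for e t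
    using n by auto
  then show ?thesis
    unfolding super_adjacent_def using dihedral_commute_iff[OF n, of e s f t] by auto
qed

lemma bex_dihedral_group:
  assumes n: "n \<ge> 1"
  shows "(\<exists>g\<in>carrier (dihedral_group n). Q g) \<longleftrightarrow> (\<exists>e t. Q (dihedral_elt n e t))"
proof
  assume "\<exists>g\<in>carrier (dihedral_group n). Q g"
  then obtain g where "g \<in> carrier (dihedral_group n)" "Q g" by (rule bexE)
  then show "\<exists>e t. Q (dihedral_elt n e t)"
    unfolding carrier_dihedral_group[OF n] by metis
next
  assume "\<exists>e t. Q (dihedral_elt n e t)"
  then show "\<exists>g\<in>carrier (dihedral_group n). Q g"
    using dihedral_elt_in_carrier[OF n] by metis
qed

text \<open>Conjugating by \<open>a\<^sup>x\<close> fixes the rotations and moves a reflection by \<open>a\<^sup>2\<^sup>x\<close>; conjugating by a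
  reflection inverts the rotations and sends \<open>a\<^sup>s b\<close> to \<open>a\<^sup>2\<^sup>x\<^sup>-\<^sup>s b\<close>, which is again a shift of \<open>s\<close> by an
  even number.\<close>

lemma conjugacy_class_dihedral:
  assumes n: "n \<ge> 1"
  shows "conjugacy_rel (dihedral_group n) `` {dihedral_elt n e s} =
    dihedral_elt n e ` (if e then {s + 2 * x | x. True} else {s, - s})"
proof -
  let ?G = "dihedral_group n" and ?elt = "dihedral_elt n"
  have conj: "?elt f x \<otimes>\<^bsub>?G\<^esub> ?elt e s \<otimes>\<^bsub>?G\<^esub> inv\<^bsub>?G\<^esub> (?elt f x) =
      ?elt e (if e then (if f then 2 * x - s else s + 2 * x) else (if f then - s else s))" for f x
    by (simp add: dihedral_mult[OF n] dihedral_inv[OF n] add.commute)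
  have mem: "g \<in> conjugacy_rel ?G `` {?elt e s} \<longleftrightarrow> (\<exists>f x. g = ?elt e
      (if e then (if f then 2 * x - s else s + 2 * x) else (if f then - s else s)))" for g
  proof -
    have "g \<in> conjugacy_rel ?G `` {?elt e s} \<longleftrightarrow> g \<in> carrier ?G \<and>
        (\<exists>y\<in>carrier ?G. g = y \<otimes>\<^bsub>?G\<^esub> ?elt e s \<otimes>\<^bsub>?G\<^esub> inv\<^bsub>?G\<^esub> y)"
      using n by (simp add: conjugacy_rel_def)
    then show ?thesis
      unfolding bex_dihedral_group[OF n] conj using dihedral_elt_in_carrier[OF n] by metis
  qed
  show ?thesis
  proof (rule Set.set_eqI)
    fix g
    show "g \<in> conjugacy_rel ?G `` {?elt e s} \<longleftrightarrow> g \<in> ?elt e ` (if e then {s + 2 * x | x. True} else {s, - s})"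
    proof (cases e)
      case True
      have "2 * x - s = s + 2 * (x - s)" for x by simp
      then have "(\<exists>f x. g = ?elt True (if f then 2 * x - s else s + 2 * x))
          \<longleftrightarrow> (\<exists>x. g = ?elt True (s + 2 * x))"
        by metis
      also have "\<dots> \<longleftrightarrow> g \<in> ?elt True ` {s + 2 * x | x. True}" by blast
      finally show ?thesis unfolding mem using True by simp
    next
      case False
      have "(\<exists>f. g = ?elt False (if f then - s else s)) \<longleftrightarrow> g \<in> ?elt False ` {s, - s}"
        by (simp add: ex_bool_eq) blast
      then show ?thesis unfolding mem using False by simp
    qed
  qed
qed

lemma dvd_add_double_iff: "(\<exists>z. int h dvd d + 2 * z) \<longleftrightarrow> int (gcd h 2) dvd d"
proof
  assume "\<exists>z. int h dvd d + 2 * z"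
  then obtain z where "int h dvd d + 2 * z" by blast
  then have "int (gcd h 2) dvd d + 2 * z" "int (gcd h 2) dvd 2 * z"
    by (auto intro: dvd_trans simp: gcd_int_int_eq[symmetric] simp del: gcd_int_int_eq)
  then show "int (gcd h 2) dvd d" by (simp add: dvd_add_left_iff)
next
  assume "int (gcd h 2) dvd d"
  then obtain l where l: "d = gcd (int h) 2 * l" by (metis dvdE gcd_int_int_eq of_nat_numeral)
  obtain u v where "u * int h + v * 2 = gcd (int h) 2" using bezout_int by blast
  then have "gcd (int h) 2 - v * 2 = u * int h" by simp
  then have "(gcd (int h) 2 - v * 2) * l = u * int h * l" by (rule arg_cong)
  then have "d + 2 * (- v * l) = int h * (u * l)" by (simp add: l algebra_simps)
  then show "\<exists>z. int h dvd d + 2 * z" by (metis dvd_triv_left)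
qed

text \<open>Conjugation shifts reflections by even amounts, so the classes of \<open>a\<^sup>s b\<close> and \<open>a\<^sup>t b\<close> contain
  commuting elements iff \<open>t - s\<close> is congruent to an even number modulo \<open>half_period n\<close>. For rotations
  nothing changes, since inversion preserves divisibility.\<close>

lemma CSCom_adjacent_iff:
  assumes n: "n \<ge> 1"
  shows "super_adjacent (dihedral_group n) (conjugacy_rel (dihedral_group n))
      (dihedral_elt n e s) (dihedral_elt n f t) \<longleftrightarrow>
    (if e then (if f then int (gcd (half_period n) 2) dvd t - s else int (half_period n) dvd t)
     else (if f then int (half_period n) dvd s else True))"
proof -
  let ?G = "dihedral_group n" and ?elt = "dihedral_elt n" and ?h = "int (half_period n)"
  let ?B = "conjugacy_rel ?G"
  note cls = conjugacy_class_dihedral[OF n] and com = dihedral_commute_iff[OF n]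
  have diff: "?B `` {?elt True s} \<noteq> ?B `` {?elt False t}" for s t
  proof -
    have "?elt True s \<in> ?B `` {?elt True s}"
      unfolding cls by (auto intro!: imageI exI[of _ 0])
    moreover have "?elt True s \<notin> ?B `` {?elt False t}"
      unfolding cls by (auto simp: dihedral_elt_eq_iff[OF n])
    ultimately show ?thesis by blast
  qed
  have rot_refl: "super_adjacent ?G ?B (?elt False s) (?elt True t) \<longleftrightarrow> ?h dvd s" for s t
    unfolding super_adjacent_def using diff[of t s] by (auto simp: cls com)
  have refl_rot: "super_adjacent ?G ?B (?elt True t) (?elt False s) \<longleftrightarrow> ?h dvd s" for s t
    using rot_refl super_adjacent_sym by metis
  have rot_rot: "super_adjacent ?G ?B (?elt False s) (?elt False t)"
    unfolding super_adjacent_def by (auto simp: cls com)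
  have refl_refl: "super_adjacent ?G ?B (?elt True s) (?elt True t) \<longleftrightarrow> int (gcd (half_period n) 2) dvd t - s"
  proof -
    have same: "\<exists>z. ?h dvd t - s + 2 * z" if "?B `` {?elt True s} = ?B `` {?elt True t}"
    proof -
      have "?elt True t \<in> ?elt True ` {t + 2 * x | x. True}"
        by (rule imageI) (auto intro: exI[of _ 0])
      then have "?elt True t \<in> ?elt True ` {s + 2 * x | x. True}"
        using that by (simp add: cls)
      then obtain x where "int n dvd t - (s + 2 * x)" by (auto simp: dihedral_elt_eq_iff[OF n])
      then have "?h dvd t - s + 2 * (- x)"
        using half_period_dvd[of n] by (auto intro: dvd_trans simp: algebra_simps)
      then show ?thesis ..
    qed
    have "(\<exists>x y. ?h dvd (t + 2 * y) - (s + 2 * x)) \<longleftrightarrow> (\<exists>z. ?h dvd t - s + 2 * z)"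
    proof
      assume "\<exists>x y. ?h dvd (t + 2 * y) - (s + 2 * x)"
      then obtain x y where "?h dvd (t + 2 * y) - (s + 2 * x)" by blast
      also have "(t + 2 * y) - (s + 2 * x) = t - s + 2 * (y - x)" by simp
      finally show "\<exists>z. ?h dvd t - s + 2 * z" ..
    next
      assume "\<exists>z. ?h dvd t - s + 2 * z"
      then obtain z where "?h dvd t - s + 2 * z" ..
      then have "?h dvd (t + 2 * z) - (s + 2 * 0)" by (simp add: algebra_simps)
      then show "\<exists>x y. ?h dvd (t + 2 * y) - (s + 2 * x)" by blast
    qed
    moreover have "super_adjacent ?G ?B (?elt True s) (?elt True t) \<longleftrightarrow>
        ?B `` {?elt True s} = ?B `` {?elt True t} \<or> (\<exists>x y. ?h dvd (t + 2 * y) - (s + 2 * x))"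
      unfolding super_adjacent_def by (auto simp only: cls com if_True simp_thms bex_simps) blast+
    ultimately show ?thesis
      using same dvd_add_double_iff by blast
  qed
  show ?thesis
    using rot_refl refl_rot rot_rot refl_refl by (cases e; cases f) simp_all
qed

lemma dihedral_pow_2_eq_one_iff:
  assumes n: "n \<ge> 1"
  shows "dihedral_elt n e t [^]\<^bsub>dihedral_group n\<^esub> (2::nat) = \<one>\<^bsub>dihedral_group n\<^esub> \<longleftrightarrow>
    e \<or> int (half_period n) dvd t"
proof -
  interpret group "dihedral_group n" by (rule group_dihedral_group)
  show ?thesis
    using n by (simp add: numeral_2_eq_2 dihedral_mult dihedral_one dihedral_elt_eq_iff
        flip: dvd_double_iff)
qed

lemma dihedral_ord_2_iff:
  assumes n: "n \<ge> 1"
  shows "group.ord (dihedral_group n) (dihedral_elt n e t) = 2 \<longleftrightarrow>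
    e \<or> (int (half_period n) dvd t \<and> \<not> int n dvd t)"
proof -
  interpret group "dihedral_group n" by (rule group_dihedral_group)
  let ?g = "dihedral_elt n e t"
  have g: "?g \<in> carrier (dihedral_group n)" using n by simp
  have "ord ?g = 2 \<longleftrightarrow> ord ?g dvd 2 \<and> ord ?g \<noteq> 1"
  proof -
    have "ord ?g dvd 2 \<Longrightarrow> ord ?g \<le> 2 \<and> ord ?g \<noteq> 0" by (auto dest: dvd_imp_le intro: gr0I)
    then show ?thesis by auto
  qed
  also have "\<dots> \<longleftrightarrow> e \<or> (int (half_period n) dvd t \<and> \<not> int n dvd t)"
    using dihedral_pow_2_eq_one_iff[OF n, of e t] pow_eq_id[OF g, of 2] ord_eq_1[OF g]
    by (auto simp: dihedral_one[OF n] dihedral_elt_eq_iff[OF n])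
  finally show ?thesis .
qed

text \<open>All reflections have order \<open>2\<close>. If \<open>n\<close> is even, their class contains the central rotation
  \<open>a\<^sup>n\<^sup>/\<^sup>2\<close>, so the graph is complete. If \<open>n\<close> is odd, no rotation has order \<open>2\<close>, and among the rotations
  only \<open>1\<close> commutes with a reflection. In terms of divisors, \<open>m = 1\<close> and \<open>q\<close> is \<open>1\<close> or \<open>n\<close>.\<close>

lemma OSCom_adjacent_iff:
  assumes n: "n \<ge> 1"
  defines "q \<equiv> if even n then 1 else n"
  shows "super_adjacent (dihedral_group n) (same_order_rel (dihedral_group n))
      (dihedral_elt n e s) (dihedral_elt n f t) \<longleftrightarrow>
    (if e then (if f then int 1 dvd t - s else int q dvd t)
     else (if f then int q dvd s else True))"
proof -
  interpret group "dihedral_group n" by (rule group_dihedral_group)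
  let ?G = "dihedral_group n" and ?elt = "dihedral_elt n" 
  let ?B = "same_order_rel ?G"
  note com = dihedral_commute_iff[OF n]
  have cls: "g \<in> ?B `` {?elt e s} \<longleftrightarrow> (\<exists>f t. g = ?elt f t \<and> ord (?elt f t) = ord (?elt e s))" for g e s
    unfolding same_order_rel_def using carrier_dihedral_group[OF n]
      dihedral_elt_in_carrier[OF n] by fastforce
  have self: "?elt e s \<in> ?B `` {?elt e s}" for e s
    unfolding cls by blast
  have ord_refl: "ord (?elt True t) = 2" for t
    by (simp add: dihedral_ord_2_iff[OF n])
  have rot_rot: "super_adjacent ?G ?B (?elt False s) (?elt False t)"
    unfolding super_adjacent_def using self com[of False s False t] by auto
  have refl_refl: "super_adjacent ?G ?B (?elt True s) (?elt True t)"
    unfolding super_adjacent_def same_order_rel_def using n ord_refl by auto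
  have rot_refl: "super_adjacent ?G ?B (?elt False s) (?elt True t) \<longleftrightarrow> int q dvd s" for s t
  proof (cases "even n")
    case True
    define h where "h = half_period n"
    have "h > 0" "h < n" using True n by (auto simp: h_def half_period_def)
    then have "ord (?elt False (int h)) = 2"
      unfolding dihedral_ord_2_iff[OF n] by (auto simp: h_def dest: nat_dvd_not_less)
    then have "?elt False (int h) \<in> ?B `` {?elt True t}"
      unfolding cls ord_refl by blast
    then have "super_adjacent ?G ?B (?elt False s) (?elt True t)"
      unfolding super_adjacent_def using self[of False s] com[of False s False "int h"] by auto
    then show ?thesis using True by (simp add: q_def)
  next
    case False
    then have h: "half_period n = n" by (simp add: half_period_def)
    have ord2: "ord (?elt e s) = 2 \<longleftrightarrow> e" for e s
      using dihedral_ord_2_iff[OF n] by (simp add: h)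
    have "int n dvd s" if adj: "super_adjacent ?G ?B (?elt False s) (?elt True t)"
    proof -
      have "?B `` {?elt False s} \<noteq> ?B `` {?elt True t}"
        using self[of False s] cls[of "?elt False s" True t] ord2 by metis
      then obtain g h where "g \<in> ?B `` {?elt False s}" "h \<in> ?B `` {?elt True t}"
        "g \<otimes>\<^bsub>?G\<^esub> h = h \<otimes>\<^bsub>?G\<^esub> g"
        using adj unfolding super_adjacent_def by blast
      then obtain e x f y where *: "ord (?elt e x) = ord (?elt False s)" "ord (?elt f y) = ord (?elt True t)"
        "?elt e x \<otimes>\<^bsub>?G\<^esub> ?elt f y = ?elt f y \<otimes>\<^bsub>?G\<^esub> ?elt e x"
        unfolding cls by metis
      then have ef: "\<not> e" "f" using ord2 by metis+
      then have "int n dvd x" using *(3) by (simp add: com h)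
      then have "?elt e x = \<one>\<^bsub>?G\<^esub>" using ef by (simp add: dihedral_one[OF n] dihedral_elt_eq_iff[OF n])
      then have "ord (?elt False s) = 1" using *(1) by simp
      then have "?elt False s = \<one>\<^bsub>?G\<^esub>" using n by (simp only: ord_eq_1 dihedral_elt_in_carrier)
      then show ?thesis
        by (simp add: dihedral_one[OF n] dihedral_elt_eq_iff[OF n])
    qed
    moreover have "super_adjacent ?G ?B (?elt False s) (?elt True t)" if "int n dvd s"
      unfolding super_adjacent_def using self[of False s] self[of True t] com[of False s True t] that h by auto
    ultimately show ?thesis using False by (auto simp: q_def)
  qed
  have refl_rot: "super_adjacent ?G ?B (?elt True t) (?elt False s) \<longleftrightarrow> int q dvd s" for s t
    using rot_refl super_adjacent_sym by metis
  show ?thesis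
    using rot_refl refl_rot rot_rot refl_refl by (cases e; cases f) simp_all
qed

theorem theorem3p2:
  fixes n :: nat and \<Gamma> :: "dihedral_gen word set ugraph"
  assumes "n \<ge> 3"
    and "\<Gamma> \<in> {ESCom (dihedral_group n), CSCom (dihedral_group n), OSCom (dihedral_group n)}"
  shows "real (zagreb2 \<Gamma>) / real (card (edges \<Gamma>)) \<ge> real (zagreb1 \<Gamma>) / real (card (verts \<Gamma>))"
proof -
  have n: "n \<ge> 1" using assms(1) by simp
  have "gcd (half_period n) 2 dvd n"
    using half_period_dvd by (rule dvd_trans[rotated]) simp
  moreover have "(if even n then 1 else n) dvd n" by simp
  ultimately show ?thesis
    using assms(2) n half_period_dvd[of n]
      Hansen_Vukicevic_dihedral[OF n _ _ ESCom_adjacent_iff[OF n]]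
      Hansen_Vukicevic_dihedral[OF n _ _ CSCom_adjacent_iff[OF n]]
      Hansen_Vukicevic_dihedral[OF n _ one_dvd OSCom_adjacent_iff[OF n]]
    by (auto simp only: ESCom_def CSCom_def OSCom_def)
qed

end
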